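(* Let $\boldsymbol{p}=(p_{n,k}: n\ge 1,\ 1\le k\le n)$ be a family of numbers in $[0,1]$, let $(a_{n,k})$ be the break points of the split-merge dynamics with splitting proportions $\boldsymbol{p}$, and let $(x_n)_{n\ge 0}$ be the associated random process, with law $\mathbb{P}^{\boldsymbol{p}}$. Then for all $n\ge 1$ and all $1\le k\le n$, $$a_{n,k}=\mathbb{P}^{\boldsymbol{p}}(x_n\le k-1).$$
   Context: Break points: $a_{n,0}=0$ and $a_{n,n+1}=1$ for all $n\ge 0$, and recursively for $n\ge 1$, $$a_{n,k}=p_{n,k}\,a_{n-1,k-1}+(1-p_{n,k})\,a_{n-1,k},\qquad k=1,\dots,n.$$ Associated process: under the probability measure $\mathbb{P}^{\boldsymbol{p}}$, $(y_{n,k}: n\ge1,\ 1\le k\le n)$ is a family of independent random variables, $y_{n,k}$ being Bernoulli with $\mathbb{P}^{\boldsymbol{p}}(y_{n,k}=1)=p_{n,k}$. The process $(x_n)_{n\ge0}$ is defined by $x_0=0$ and $x_n=x_{n-1}+y_{n,\,x_{n-1}+1}$ for $n\ge1$ (so $x_n\in\{0,1,\dots,n\}$). *)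

theory Defs
  imports "HOL-Probability.Probability"
begin

text \<open>
  Only the entries \<open>k \<le> n + 1\<close> of row \<open>n\<close> are break points; the value \<open>1\<close> for \<open>k > n + 1\<close>
  is a junk value that the recursion never reads for indices in range.
\<close>

fun break_point :: "(nat \<Rightarrow> nat \<Rightarrow> real) \<Rightarrow> nat \<Rightarrow> nat \<Rightarrow> real" where
  "break_point p 0 k = (if k = 0 then 0 else 1)"
| "break_point p (Suc n) k =
    (if k = 0 then 0
     else if k > Suc n then 1
     else p (Suc n) k * break_point p n (k - 1) + (1 - p (Suc n) k) * break_point p n k)"

definition tri_index :: "(nat \<times> nat) set" where
  "tri_index = {(n, k). 1 \<le> n \<and> 1 \<le> k \<and> k \<le> n}"

primrec process :: "(nat \<Rightarrow> nat \<Rightarrow> 'w \<Rightarrow> nat) \<Rightarrow> nat \<Rightarrow> 'w \<Rightarrow> nat" where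
  "process y 0 \<omega> = 0"
| "process y (Suc n) \<omega> = process y n \<omega> + y (Suc n) (process y n \<omega> + 1) \<omega>"

text \<open>
  The probability space is arbitrary: \<open>M\<close> may be any space carrying such a family.
  The variables take the values 0 and 1 everywhere, not only almost surely, so that
  \<open>process y (n - 1) \<omega> + 1 \<le> n\<close> always holds and no \<open>y n k\<close> outside \<open>tri_index\<close> is ever read.
\<close>

definition bernoulli_family ::
  "'w measure \<Rightarrow> (nat \<Rightarrow> nat \<Rightarrow> real) \<Rightarrow> (nat \<Rightarrow> nat \<Rightarrow> 'w \<Rightarrow> nat) \<Rightarrow> bool" where
  "bernoulli_family M p y \<longleftrightarrow>
     prob_space M \<and>
     prob_space.indep_vars M (\<lambda>_. count_space UNIV) (\<lambda>(n, k). y n k) tri_index \<and>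
     (\<forall>(n, k) \<in> tri_index.
        (\<forall>\<omega> \<in> space M. y n k \<omega> \<in> {0, 1}) \<and>
        measure M {\<omega> \<in> space M. y n k \<omega> = 1} = p n k)"

end

theory Submission
  imports Defs
begin

text \<open>
  The break points are the distribution function of the process: both sides satisfy the same
  recursion. Since the increments are 0 or 1, the event \<open>x\<^sub>n\<^sub>+\<^sub>1 < k\<close> is the disjoint union of
  \<open>x\<^sub>n < k - 1\<close> and of \<open>x\<^sub>n = k - 1 \<and> y\<^sub>n\<^sub>+\<^sub>1\<^sub>,\<^sub>k = 0\<close>. The position \<open>x\<^sub>n\<close> depends only on rows
  \<open>1, \<dots>, n\<close> of the family, hence is independent of \<open>y\<^sub>n\<^sub>+\<^sub>1\<^sub>,\<^sub>k\<close> (\<open>prob_process_and_next\<close>), so that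
  with \<open>F\<^sub>n k = P (x\<^sub>n < k)\<close>
  \[ F_{n+1}(k) = F_n(k-1) + (1 - p_{n+1,k}) (F_n(k) - F_n(k-1))
     = p_{n+1,k} F_n(k-1) + (1 - p_{n+1,k}) F_n(k), \]
  which is the recursion of the break points. Using the strict inequality \<open>x\<^sub>n < k\<close> makes the
  boundary rows fit the induction for every natural number \<open>k\<close>: the event is empty for \<open>k = 0\<close>
  and certain for \<open>k > n\<close>.
\<close>

lemma process_le:
  assumes "\<And>m j. (m, j) \<in> tri_index \<Longrightarrow> y m j \<omega> \<le> 1"
  shows "process y n \<omega> \<le> n"
proof (induction n)
  case (Suc n)
  then have "(Suc n, process y n \<omega> + 1) \<in> tri_index"
    by (simp add: tri_index_def)
  from assms[OF this] Suc show ?case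
    by simp
qed simp

text \<open>
  The first \<open>n\<close> rows inside the triangle determine \<open>x\<^sub>n\<close>, since the bound above keeps the
  process from reading any entry outside it. The two sample points may lie in different spaces,
  which lets \<open>x\<^sub>n\<close> be rewritten as a function on a product space.
\<close>

lemma process_cong:
  assumes bound: "\<And>m j. (m, j) \<in> tri_index \<Longrightarrow> y m j \<omega> \<le> 1"
    and eq: "\<And>m j. (m, j) \<in> tri_index \<Longrightarrow> m \<le> n \<Longrightarrow> y m j \<omega> = z m j \<omega>'"
  shows "process y n \<omega> = process z n \<omega>'"
  using eq
proof (induction n)
  case (Suc n)
  then have "process y n \<omega> = process z n \<omega>'"
    by simp
  moreover have "(Suc n, process y n \<omega> + 1) \<in> tri_index"
    using process_le[of y \<omega> n] bound by (simp add: tri_index_def)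
  ultimately show ?case
    using Suc.prems[of "Suc n" "process y n \<omega> + 1"] by simp
qed simp

lemma measurable_process:
  assumes "\<And>m j. y m j \<in> measurable M (count_space UNIV)"
  shows "process y n \<in> measurable M (count_space UNIV)"
proof (induction n)
  case (Suc n)
  have "(\<lambda>\<omega>. (\<lambda>i \<omega>. i + y (Suc n) (i + 1) \<omega>) (process y n \<omega>) \<omega>)
      \<in> measurable M (count_space UNIV)"
    by (rule measurable_compose_countable[OF _ Suc])
      (rule measurable_compose[OF assms], simp)
  then show ?case
    by simp
qed simp

lemma bernoulli_family_D:
  assumes "bernoulli_family M p y"
  shows "prob_space M"
    and "prob_space.indep_vars M (\<lambda>_. count_space UNIV) (\<lambda>(n, k). y n k) tri_index"
    and "(n, k) \<in> tri_index \<Longrightarrow> \<omega> \<in> space M \<Longrightarrow> y n k \<omega> \<in> {0, 1}"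
    and "(n, k) \<in> tri_index \<Longrightarrow> measure M {\<omega> \<in> space M. y n k \<omega> = 1} = p n k"
  using assms unfolding bernoulli_family_def by auto

lemma measurable_bernoulli_family:
  assumes "bernoulli_family M p y" and "(m, j) \<in> tri_index"
  shows "y m j \<in> measurable M (count_space UNIV)"
proof -
  interpret prob_space M by (rule bernoulli_family_D(1)[OF assms(1)])
  show ?thesis
    using bernoulli_family_D(2)[OF assms(1)] assms(2) unfolding indep_vars_def by auto
qed

lemma measurable_bernoulli_process:
  assumes "bernoulli_family M p y"
  shows "process y n \<in> measurable M (count_space UNIV)"
proof -
  \<comment> \<open>Entries outside the triangle need not be measurable, so they are replaced by 0.\<close>
  define z where "z m j \<omega> = (if (m, j) \<in> tri_index then y m j \<omega> else 0)" for m j \<omega>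
  have "z m j \<in> measurable M (count_space UNIV)" for m j
    using measurable_bernoulli_family[OF assms, of m j]
    by (cases "(m, j) \<in> tri_index") (simp_all add: z_def[abs_def])
  then have "process z n \<in> measurable M (count_space UNIV)"
    by (rule measurable_process)
  moreover have "process y n \<omega> = process z n \<omega>" if "\<omega> \<in> space M" for \<omega>
  proof (rule process_cong)
    show "y m j \<omega> \<le> 1" if "(m, j) \<in> tri_index" for m j
      using bernoulli_family_D(3)[OF assms that \<open>\<omega> \<in> space M\<close>] by auto
  qed (simp add: z_def)
  ultimately show ?thesis
    by (simp cong: measurable_cong)
qed

text \<open>
  The rows \<open>1, \<dots>, n\<close> and the single index \<open>(n + 1, k)\<close> are disjoint blocks of an independent
  family, so functions of the two blocks are independent; \<open>x\<^sub>n\<close> is a function of the first.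
\<close>

lemma prob_process_and_next:
  assumes B: "bernoulli_family M p y" and k: "1 \<le> k" "k \<le> Suc n"
  shows "measure M {\<omega> \<in> space M. process y n \<omega> = i \<and> y (Suc n) k \<omega> = j} =
    measure M {\<omega> \<in> space M. process y n \<omega> = i} * measure M {\<omega> \<in> space M. y (Suc n) k \<omega> = j}"
proof -
  interpret prob_space M by (rule bernoulli_family_D(1)[OF B])
  define A where "A = {(m, l). (m, l) \<in> tri_index \<and> m \<le> n}"
  define N where "N = (\<lambda>_ :: nat \<times> nat. count_space (UNIV :: nat set))"
  define rA where "rA \<omega> = (\<lambda>i \<in> A. y (fst i) (snd i) \<omega>)" for \<omega>
  define rB where "rB \<omega> = (\<lambda>i \<in> {(Suc n, k)}. y (fst i) (snd i) \<omega>)" for \<omega>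
  define z where "z m l f = (if (m, l) \<in> A then f (m, l) else 0)"
    for m l and f :: "nat \<times> nat \<Rightarrow> nat"
  have "indep_vars (\<lambda>_. count_space UNIV) (\<lambda>i. y (fst i) (snd i)) tri_index"
    using bernoulli_family_D(2)[OF B] by (simp add: case_prod_unfold)
  then have "indep_var (PiM A N) rA (PiM {(Suc n, k)} N) rB"
    unfolding rA_def rB_def N_def
    by (rule indep_var_restrict) (use k in \<open>auto simp: A_def tri_index_def\<close>)
  moreover have "z m l \<in> measurable (PiM A N) (count_space UNIV)" for m l
  proof (cases "(m, l) \<in> A")
    case True
    then have "(\<lambda>f. f (m, l)) \<in> measurable (PiM A N) (N (m, l))"
      by (rule measurable_component_singleton)
    with True show ?thesis
      by (simp add: z_def[abs_def] N_def)
  qed (simp add: z_def[abs_def])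
  then have "process z n \<in> measurable (PiM A N) (count_space UNIV)"
    by (rule measurable_process)
  moreover have "(\<lambda>f. f (Suc n, k)) \<in> measurable (PiM {(Suc n, k)} N) (N (Suc n, k))"
    by (rule measurable_component_singleton) simp
  then have "(\<lambda>f. f (Suc n, k)) \<in> measurable (PiM {(Suc n, k)} N) (count_space UNIV)"
    by (simp add: N_def)
  ultimately have "indep_var (count_space UNIV) (process z n \<circ> rA)
      (count_space UNIV) ((\<lambda>f. f (Suc n, k)) \<circ> rB)"
    by (rule indep_var_compose)
  moreover have "((\<lambda>f. f (Suc n, k)) \<circ> rB) = y (Suc n) k"
    by (auto simp: rB_def)
  ultimately have ind: "indep_var (count_space UNIV) (process z n \<circ> rA)
      (count_space UNIV) (y (Suc n) k)"
    by simp
  have eq: "process y n \<omega> = process z n (rA \<omega>)" if "\<omega> \<in> space M" for \<omega>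
  proof (rule process_cong)
    show "y m l \<omega> \<le> 1" if "(m, l) \<in> tri_index" for m l
      using bernoulli_family_D(3)[OF B that \<open>\<omega> \<in> space M\<close>] by auto
  qed (simp add: z_def rA_def A_def)
  have "prob {\<omega> \<in> space M. process y n \<omega> = i \<and> y (Suc n) k \<omega> = j} =
      \<P>(\<omega> in M. (process z n \<circ> rA) \<omega> \<in> {i} \<and> y (Suc n) k \<omega> \<in> {j})"
    by (rule arg_cong[where f = prob]) (auto simp: eq)
  also have "\<dots> = \<P>(\<omega> in M. (process z n \<circ> rA) \<omega> \<in> {i}) * \<P>(\<omega> in M. y (Suc n) k \<omega> \<in> {j})"
    by (rule prob_indep_random_variable[OF ind]) simp_all
  also have "{\<omega> \<in> space M. (process z n \<circ> rA) \<omega> \<in> {i}} = {\<omega> \<in> space M. process y n \<omega> = i}"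
    by (auto simp: eq)
  finally show ?thesis
    by simp
qed

lemma break_point_eq_prob_process_less:
  assumes B: "bernoulli_family M p y"
  shows "break_point p n k = measure M {\<omega> \<in> space M. process y n \<omega> < k}"
proof (induction n arbitrary: k)
  interpret prob_space M by (rule bernoulli_family_D(1)[OF B])
  case 0
  show ?case
    by (simp add: prob_space)
next
  interpret prob_space M by (rule bernoulli_family_D(1)[OF B])
  case (Suc n)
  have bound: "process y m \<omega> \<le> m" if "\<omega> \<in> space M" for m \<omega>
  proof (rule process_le)
    show "y m l \<omega> \<le> 1" if "(m, l) \<in> tri_index" for m l
      using bernoulli_family_D(3)[OF B that \<open>\<omega> \<in> space M\<close>] by auto
  qed
  consider "k = 0" | "k > Suc n" | "1 \<le> k" "k \<le> Suc n"
    by linarith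
  then show ?case
  proof cases
    case 1
    then show ?thesis
      by simp
  next
    case 2
    then have "{\<omega> \<in> space M. process y (Suc n) \<omega> < k} = space M"
      using bound[of _ "Suc n"] by (auto simp del: process.simps intro: le_less_trans)
    with 2 show ?thesis
      by (simp add: prob_space del: process.simps)
  next
    case 3
    let ?q = "p (Suc n) k"
    let ?lt = "{\<omega> \<in> space M. process y n \<omega> < k - 1}"
    let ?at = "{\<omega> \<in> space M. process y n \<omega> = k - 1}"
    let ?stay = "{\<omega> \<in> space M. process y n \<omega> = k - 1 \<and> y (Suc n) k \<omega> = 0}"
    have tri: "(Suc n, k) \<in> tri_index"
      using 3 by (simp add: tri_index_def)
    note [measurable] = measurable_bernoulli_process[OF B] measurable_bernoulli_family[OF B tri]
    have "{\<omega> \<in> space M. y (Suc n) k \<omega> = 0} = space M - {\<omega> \<in> space M. y (Suc n) k \<omega> = 1}"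
      using bernoulli_family_D(3)[OF B tri] by auto
    then have zero: "prob {\<omega> \<in> space M. y (Suc n) k \<omega> = 0} = 1 - ?q"
      using bernoulli_family_D(4)[OF B tri] by (simp add: prob_compl)
    have "{\<omega> \<in> space M. process y n \<omega> < k} = ?lt \<union> ?at"
      using 3 by auto
    then have "prob {\<omega> \<in> space M. process y n \<omega> < k} = prob ?lt + prob ?at"
      by (simp only:) (rule finite_measure_Union, auto)
    then have at: "prob ?at = break_point p n k - break_point p n (k - 1)"
      by (simp add: Suc)
    have "\<omega> \<in> {\<omega> \<in> space M. process y (Suc n) \<omega> < k} \<longleftrightarrow> \<omega> \<in> ?lt \<union> ?stay" for \<omega>
    proof (cases "\<omega> \<in> space M")
      case True
      consider "process y n \<omega> < k - 1" | "process y n \<omega> = k - 1" | "process y n \<omega> > k - 1"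
        by linarith
      then show ?thesis
      proof cases
        case 1
        have "(Suc n, process y n \<omega> + 1) \<in> tri_index"
          using bound[OF True, of n] by (simp add: tri_index_def)
        from bernoulli_family_D(3)[OF B this True] 1 True show ?thesis
          by auto
      qed (use True 3 in auto)
    qed simp
    then have "{\<omega> \<in> space M. process y (Suc n) \<omega> < k} = ?lt \<union> ?stay"
      by blast
    then have "prob {\<omega> \<in> space M. process y (Suc n) \<omega> < k} = prob ?lt + prob ?stay"
      by (simp only:) (rule finite_measure_Union, auto)
    also have "\<dots> = prob ?lt + prob ?at * (1 - ?q)"
      using prob_process_and_next[OF B, of k n "k - 1" 0] 3 zero by simp
    also have "\<dots> = ?q * break_point p n (k - 1) + (1 - ?q) * break_point p n k"
      by (simp only: at Suc[symmetric]) (simp add: algebra_simps)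
    finally show ?thesis
      using 3 by simp
  qed
qed

theorem proposition2p1:
  fixes p :: "nat \<Rightarrow> nat \<Rightarrow> real"
    and M :: "'w measure"
    and y :: "nat \<Rightarrow> nat \<Rightarrow> 'w \<Rightarrow> nat"
  assumes "\<forall>(n, k) \<in> tri_index. p n k \<in> {0..1}"
    and "bernoulli_family M p y"
  shows "\<forall>n \<ge> 1. \<forall>k \<in> {1..n}.
    break_point p n k = measure M {\<omega> \<in> space M. process y n \<omega> \<le> k - 1}"
proof (intro allI impI ballI)
  fix n k :: nat
  assume "k \<in> {1..n}"
  then have "process y n \<omega> < k \<longleftrightarrow> process y n \<omega> \<le> k - 1" for \<omega>
    by auto
  then show "break_point p n k = measure M {\<omega> \<in> space M. process y n \<omega> \<le> k - 1}"
    using break_point_eq_prob_process_less[OF assms(2), of n k] by simp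
qed

end
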